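(* Let $Q\subset\otimes_{i=1}^{l}\mathbb{R}^{d_{i}}$ be a tensorial body. Then $Q^{\circ}$ and $\lambda Q$, $\lambda>0$, are tensorial bodies. Indeed, if $Q\in\mathcal{B}_{Q_{1},\ldots,Q_{l}}\left(\otimes_{i=1}^{l}\mathbb{R}^{d_{i}}\right)$ for some $0$-symmetric convex bodies $Q_{i}\subset\mathbb{R}^{d_{i}}$, $i=1,\ldots,l$, then (1) $Q^{\circ}\in\mathcal{B}_{Q_{1}^{\circ},\ldots,Q_{l}^{\circ}}\left(\otimes_{i=1}^{l}\mathbb{R}^{d_{i}}\right)$; (2) for every $\lambda>0$ and every $k\in\{1,\dots,l\}$, $\lambda Q\in\mathcal{B}_{ Q_{1},\ldots,Q_{k-1},\lambda Q_{k},Q_{k+1},\ldots,Q_{l}}\left(\otimes_{i=1}^{l}\mathbb{R}^{d_{i}}\right)$.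
   Context: Here $l$ and $d_1,\dots,d_l$ are positive integers. $\langle\cdot,\cdot\rangle$ is the standard scalar product on $\mathbb{R}^{d}$, and $\langle\cdot,\cdot\rangle_H$ is the scalar product on $\otimes_{i=1}^l\mathbb{R}^{d_i}$ determined by $\langle x^1\otimes\cdots\otimes x^l,y^1\otimes\cdots\otimes y^l\rangle_H=\prod_{i=1}^l\langle x^i,y^i\rangle$. In a Euclidean space $\mathbb{E}$, a convex body is a compact convex set with nonempty interior; it is $0$-symmetric if $P=-P$. The polar set of a nonempty $C\subset\mathbb{E}$ is $C^\circ=\{y\in\mathbb{E}:\sup_{x\in C}|\langle x,y\rangle_{\mathbb{E}}|\le 1\}$ (with $\langle\cdot,\cdot\rangle$ in $\mathbb{R}^{d_i}$ and $\langle\cdot,\cdot\rangle_H$ in the tensor product). For $0$-symmetric convex bodies $Q_i\subset\mathbb{R}^{d_i}$: $Q_1\otimes_\pi\cdots\otimes_\pi Q_l:=\mathrm{conv}\{x^1\otimes\cdots\otimes x^l:x^i\in Q_i,\ i=1,\dots,l\}$ and $Q_1\otimes_\epsilon\cdots\otimes_\epsilon Q_l:=(Q_1^\circ\otimes_\pi\cdots\otimes_\pi Q_l^\circ)^\circ$. The set $\mathcal{B}_{Q_1,\ldots,Q_l}(\otimes_{i=1}^l\mathbb{R}^{d_i})$ consists of the $0$-symmetric convex bodies $Q\subset\otimes_{i=1}^l\mathbb{R}^{d_i}$ with $Q_{1}\otimes_{\pi}\cdots\otimes_{\pi}Q_{l}\subseteq Q\subseteq Q_{1}\otimes_{\epsilon}\cdots\otimes_{\epsilon}Q_{l}$.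 A $0$-symmetric convex body is a tensorial body in $\otimes_{i=1}^l\mathbb{R}^{d_i}$ if it belongs to $\mathcal{B}_{Q_1,\ldots,Q_l}(\otimes_{i=1}^l\mathbb{R}^{d_i})$ for some $0$-symmetric convex bodies $Q_i\subset\mathbb{R}^{d_i}$. *)

theory Defs
  imports "HOL-Analysis.Analysis"
begin

text \<open>
  The factor spaces have different dimensions, so none of them can be a type of its own.
  The positions of the factors are the elements of a finite type \<open>'l\<close> (so \<open>l = CARD('l)\<close>), and
  \<open>D i\<close> is a nonempty set of coordinate indices inside a common finite type \<open>'n\<close>, of
  cardinality \<open>d\<^sub>i = card (D i)\<close>. The \<open>i\<close>-th factor is \<open>\<real>^(D i)\<close>, realised as the coordinate
  subspace \<open>coord_space (D i)\<close> of \<open>real ^ 'n\<close>. The tensor product is realised as arrays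
  \<open>(t f)\<close> indexed by multi-indices \<open>f\<close> with \<open>f i \<in> D i\<close>. Since \<open>'l\<close> and \<open>'n\<close> are arbitrary, all \<open>l\<close>
  and all \<open>d\<^sub>1, \<dots>, d\<^sub>l\<close> are covered.
\<close>

definition coord_space :: "'k::finite set \<Rightarrow> (real ^ 'k) set" where
  "coord_space J = {x. \<forall>j. j \<notin> J \<longrightarrow> x $ j = 0}"

definition tensor_space :: "('l::finite \<Rightarrow> 'n::finite set) \<Rightarrow> (real ^ ('l \<Rightarrow> 'n)) set" where
  "tensor_space D = coord_space {f. \<forall>i. f i \<in> D i}"

definition elem_tensor :: "('l::finite \<Rightarrow> real ^ 'n::finite) \<Rightarrow> real ^ ('l \<Rightarrow> 'n)" where
  "elem_tensor x = (\<chi> f. \<Prod>i\<in>UNIV. x i $ f i)"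

text \<open>
  In the following notions \<open>V\<close> is the ambient Euclidean space, a linear subspace of the type:
  interiors and polars are taken inside \<open>V\<close>.
\<close>

definition sym_convex_body :: "'a::euclidean_space set \<Rightarrow> 'a set \<Rightarrow> bool" where
  "sym_convex_body V P \<longleftrightarrow>
     P \<subseteq> V \<and> compact P \<and> convex P \<and> top_of_set V interior_of P \<noteq> {} \<and> P = uminus ` P"

text \<open>The supremum is formed in \<open>ereal\<close> because it is infinite when the functional is unbounded on \<open>C\<close>.\<close>

definition polar :: "'a::euclidean_space set \<Rightarrow> 'a set \<Rightarrow> 'a set" where
  "polar V C = {y \<in> V. (SUP x\<in>C. ereal \<bar>x \<bullet> y\<bar>) \<le> 1}"

definition proj_tensor :: "('l::finite \<Rightarrow> (real ^ 'n::finite) set) \<Rightarrow> (real ^ ('l \<Rightarrow> 'n)) set" where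
  "proj_tensor Qs = convex hull {elem_tensor x |x. \<forall>i. x i \<in> Qs i}"

definition inj_tensor ::
  "('l::finite \<Rightarrow> 'n::finite set) \<Rightarrow> ('l \<Rightarrow> (real ^ 'n) set) \<Rightarrow> (real ^ ('l \<Rightarrow> 'n)) set" where
  "inj_tensor D Qs =
     polar (tensor_space D) (proj_tensor (\<lambda>i. polar (coord_space (D i)) (Qs i)))"

text \<open>
  The class \<open>\<B>\<close> of the bodies \<open>Q\<^sub>1, \<dots>, Q\<^sub>l\<close> makes sense only for 0-symmetric convex
  bodies \<open>Q\<^sub>i\<close>, so that a membership statement includes that they are.
\<close>

definition tensor_bodies ::
  "('l::finite \<Rightarrow> 'n::finite set) \<Rightarrow> ('l \<Rightarrow> (real ^ 'n) set) \<Rightarrow> (real ^ ('l \<Rightarrow> 'n)) set set" where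
  "tensor_bodies D Qs =
     {Q. (\<forall>i. sym_convex_body (coord_space (D i)) (Qs i)) \<and>
         sym_convex_body (tensor_space D) Q \<and>
         proj_tensor Qs \<subseteq> Q \<and> Q \<subseteq> inj_tensor D Qs}"

definition tensorial_body ::
  "('l::finite \<Rightarrow> 'n::finite set) \<Rightarrow> (real ^ ('l \<Rightarrow> 'n)) set \<Rightarrow> bool" where
  "tensorial_body D Q \<longleftrightarrow>
     (\<exists>Qs. (\<forall>i. sym_convex_body (coord_space (D i)) (Qs i)) \<and> Q \<in> tensor_bodies D Qs)"

text \<open>
  The next lemmas justify the model: elementary tensors of the factors span
  \<open>tensor_space D\<close>, whose dimension is the product of the \<open>d\<^sub>i\<close>, and the standard inner
  product of arrays is the one determined by the product formula on elementary tensors.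
\<close>

lemma inner_elem_tensor: "elem_tensor x \<bullet> elem_tensor y = (\<Prod>i\<in>UNIV. x i \<bullet> y i)"
proof -
  have "(\<Prod>i\<in>UNIV. \<Sum>j\<in>UNIV. x i $ j * y i $ j)
      = (\<Sum>f\<in>PiE UNIV (\<lambda>_. UNIV). \<Prod>i\<in>UNIV. x i $ f i * y i $ f i)"
    by (rule prod_sum_PiE) auto
  then show ?thesis
    by (simp add: inner_vec_def elem_tensor_def prod.distrib PiE_UNIV_domain)
qed

lemma dim_coord_space: "dim (coord_space J) = card J"
  using dim_substandard_cart[of J, where ?'a = real]
  by (simp add: coord_space_def dim_vec_eq)

lemma dim_tensor_space: "dim (tensor_space D) = (\<Prod>i\<in>UNIV. dim (coord_space (D i)))"
proof -
  have "{f. \<forall>i. f i \<in> D i} = PiE UNIV D"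
    by (auto simp: PiE_def)
  then show ?thesis
    by (simp add: tensor_space_def dim_coord_space card_PiE)
qed

lemma span_elem_tensor:
  "span {elem_tensor x |x. \<forall>i. x i \<in> coord_space (D i)} = tensor_space D" (is "span ?E = _")
proof
  have "subspace (tensor_space D)"
    by (auto simp: tensor_space_def coord_space_def subspace_def)
  moreover have "?E \<subseteq> tensor_space D"
    by (fastforce simp: tensor_space_def coord_space_def elem_tensor_def prod_zero_iff)
  ultimately show "span ?E \<subseteq> tensor_space D"
    by (simp add: span_minimal)
  show "tensor_space D \<subseteq> span ?E"
  proof
    fix t assume t: "t \<in> tensor_space D"
    have ax: "axis f 1 = elem_tensor (\<lambda>i. axis (f i) 1)" for f :: "'a \<Rightarrow> 'b"
    proof -
      have "(if g = f then 1 else 0) = (\<Prod>i\<in>UNIV. if g i = f i then 1 else 0 :: real)" for g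
        by (auto simp: fun_eq_iff prod_zero_iff)
      then show ?thesis
        by (simp add: vec_eq_iff axis_def elem_tensor_def)
    qed
    have "t $ f *\<^sub>R axis f 1 \<in> span ?E" for f
    proof (cases "\<forall>i. f i \<in> D i")
      case True
      then have "axis f 1 \<in> ?E"
        unfolding ax by (force simp: coord_space_def axis_def)
      then show ?thesis
        by (simp add: span_base span_mul)
    next
      case False
      then show ?thesis
        using t by (auto simp: tensor_space_def coord_space_def span_zero)
    qed
    then have "(\<Sum>f\<in>UNIV. t $ f *\<^sub>R axis f 1) \<in> span ?E"
      by (rule span_sum)
    then show "t \<in> span ?E"
      using basis_expansion[of t] by (simp add: scalar_mult_eq_scaleR)
  qed
qed

end

theory Submission
  imports Defs
begin

text \<open>
  For a 0-symmetric convex subset of a linear subspace \<open>V\<close>, having nonempty interior in \<open>V\<close>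
  amounts to containing a ball of \<open>V\<close> about the origin (\<open>sym_convex_body_iff\<close>). Polarity exchanges
  "contained in a ball" with "contains a ball", so it preserves 0-symmetric convex bodies
  (\<open>sym_convex_body_polar\<close>), and it is an involution on them by the bipolar theorem
  (\<open>polar_polar\<close>).

  Duality of the two extreme tensor products then gives the statement about \<open>Q\<^sup>\<circ>\<close>. The upper bound
  \<open>Q \<subseteq> (Q\<^sub>1\<^sup>\<circ> \<otimes>\<^sub>\<pi> \<dots> \<otimes>\<^sub>\<pi> Q\<^sub>l\<^sup>\<circ>)\<^sup>\<circ>\<close> says that all pairings between \<open>Q\<close> and
  \<open>Q\<^sub>1\<^sup>\<circ> \<otimes>\<^sub>\<pi> \<dots> \<otimes>\<^sub>\<pi> Q\<^sub>l\<^sup>\<circ>\<close> are bounded by one, which read from the other side is the lower bound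
  for \<open>Q\<^sup>\<circ>\<close>. Taking polars in the lower bound \<open>Q\<^sub>1 \<otimes>\<^sub>\<pi> \<dots> \<otimes>\<^sub>\<pi> Q\<^sub>l \<subseteq> Q\<close> and replacing each \<open>Q\<^sub>i\<close> by
  \<open>Q\<^sub>i\<^sup>\<circ>\<^sup>\<circ>\<close> is the upper bound for \<open>Q\<^sup>\<circ>\<close>.

  The statement about \<open>\<lambda>Q\<close> holds because an elementary tensor is homogeneous in each single
  factor, so a scalar can be absorbed by any chosen \<open>Q\<^sub>k\<close>; on the polar side the same scalar
  moves across the inner product.
\<close>

section \<open>Polar sets\<close>

lemma subspace_coord_space: "subspace (coord_space J)"
  by (auto simp: coord_space_def subspace_def)

lemma subspace_tensor_space: "subspace (tensor_space D)"
  by (simp add: tensor_space_def subspace_coord_space)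

lemma mem_polar_iff: "y \<in> polar V C \<longleftrightarrow> y \<in> V \<and> (\<forall>x\<in>C. \<bar>x \<bullet> y\<bar> \<le> 1)"
  by (simp add: polar_def SUP_le_iff)

lemma polar_antimono: "A \<subseteq> B \<Longrightarrow> polar V B \<subseteq> polar V A"
  by (fastforce simp: mem_polar_iff)

text \<open>For a fixed \<open>y\<close>, the points whose pairing with \<open>y\<close> has absolute value at most one form a
  convex slab, so only the generators of a convex hull need to be tested.\<close>

lemma polar_convex_hull: "polar V (convex hull S) = polar V S"
proof
  show "polar V (convex hull S) \<subseteq> polar V S"
    by (intro polar_antimono hull_subset)
  show "polar V S \<subseteq> polar V (convex hull S)"
  proof
    fix y assume y: "y \<in> polar V S"
    have "{x. \<bar>x \<bullet> y\<bar> \<le> 1} = {x. y \<bullet> x \<le> 1} \<inter> {x. y \<bullet> x \<ge> -1}"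
      by (auto simp: inner_commute)
    then have "convex {x. \<bar>x \<bullet> y\<bar> \<le> 1}"
      by (simp add: convex_Int convex_halfspace_le convex_halfspace_ge)
    moreover have "S \<subseteq> {x. \<bar>x \<bullet> y\<bar> \<le> 1}"
      using y by (auto simp: mem_polar_iff)
    ultimately have "convex hull S \<subseteq> {x. \<bar>x \<bullet> y\<bar> \<le> 1}"
      by (simp add: hull_minimal)
    then show "y \<in> polar V (convex hull S)"
      using y by (auto simp: mem_polar_iff)
  qed
qed

lemma mem_polar_scaleR_image_iff:
  assumes "subspace V" "c \<noteq> 0"
  shows "y \<in> polar V ((*\<^sub>R) c ` C) \<longleftrightarrow> c *\<^sub>R y \<in> polar V C"
proof -
  have "c *\<^sub>R y \<in> V \<longleftrightarrow> y \<in> V"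
    using subspace_scale[OF assms(1), of y c] subspace_scale[OF assms(1), of "c *\<^sub>R y" "1 / c"]
      assms(2) by auto
  then show ?thesis
    by (simp add: mem_polar_iff)
qed

section \<open>0-symmetric convex bodies in a subspace\<close>

text \<open>Averaging a ball about an interior point \<open>x\<close> with the opposite point \<open>-x\<close> gives a ball of
  half the radius about the origin.\<close>

lemma sym_convex_body_iff:
  assumes V: "subspace V"
  shows "sym_convex_body V P \<longleftrightarrow>
    P \<subseteq> V \<and> compact P \<and> convex P \<and> P = uminus ` P \<and> (\<exists>e>0. V \<inter> ball 0 e \<subseteq> P)"
proof -
  have "top_of_set V interior_of P \<noteq> {} \<longleftrightarrow> (\<exists>e>0. V \<inter> ball 0 e \<subseteq> P)"
    if "convex P" and sym: "P = uminus ` P"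
  proof
    assume "top_of_set V interior_of P \<noteq> {}"
    then obtain x T where "openin (top_of_set V) T" "x \<in> T" "T \<subseteq> P"
      by (auto simp: interior_of_def)
    then obtain e where "T \<subseteq> V" and "e > 0" and "ball x e \<inter> V \<subseteq> T"
      unfolding openin_contains_ball by blast
    then have e: "e > 0" "ball x e \<inter> V \<subseteq> P" and x: "x \<in> V" "x \<in> P"
      using \<open>x \<in> T\<close> \<open>T \<subseteq> P\<close> by blast+
    have "V \<inter> ball 0 (e/2) \<subseteq> P"
    proof
      fix y assume y: "y \<in> V \<inter> ball 0 (e/2)"
      then have "x + 2 *\<^sub>R y \<in> ball x e \<inter> V"
        using V x by (auto simp: dist_norm subspace_add subspace_scale)
      then have "x + 2 *\<^sub>R y \<in> P"
        using e by blast
      moreover have "- x \<in> P"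
        using sym x by blast
      ultimately have "(1/2) *\<^sub>R (x + 2 *\<^sub>R y) + (1/2) *\<^sub>R (- x) \<in> P"
        by (intro convexD[OF \<open>convex P\<close>]) auto
      then show "y \<in> P"
        by (simp add: algebra_simps)
    qed
    then show "\<exists>e>0. V \<inter> ball 0 e \<subseteq> P"
      using e by (intro exI[of _ "e/2"]) auto
  next
    assume "\<exists>e>0. V \<inter> ball 0 e \<subseteq> P"
    then obtain e where e: "e > 0" "V \<inter> ball 0 e \<subseteq> P"
      by blast
    then have "V \<inter> ball 0 e \<subseteq> top_of_set V interior_of P"
      by (intro interior_of_maximal openin_open_Int open_ball)
    moreover have "0 \<in> V \<inter> ball 0 e"
      using e V by (simp add: subspace_0)
    ultimately show "top_of_set V interior_of P \<noteq> {}"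
      by blast
  qed
  then show ?thesis
    unfolding sym_convex_body_def by blast
qed

lemma sym_convex_body_zero:
  assumes "subspace V" "sym_convex_body V P"
  shows "0 \<in> P"
proof -
  obtain e where "e > 0" "V \<inter> ball 0 e \<subseteq> P"
    using assms(2) unfolding sym_convex_body_iff[OF assms(1)] by blast
  then show ?thesis
    using assms(1) by (force simp: subspace_0)
qed

lemma sym_convex_body_scaleR:
  assumes V: "subspace V" and P: "sym_convex_body V P" and c: "c > 0"
  shows "sym_convex_body V ((*\<^sub>R) c ` P)"
proof -
  obtain e where e: "e > 0" "V \<inter> ball 0 e \<subseteq> P"
    and "P \<subseteq> V" "compact P" "convex P" and sym: "uminus ` P = P"
    using P unfolding sym_convex_body_iff[OF V] by metis
  have "V \<inter> ball 0 (c * e) \<subseteq> (*\<^sub>R) c ` P"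
  proof
    fix y assume y: "y \<in> V \<inter> ball 0 (c * e)"
    then have "(1/c) *\<^sub>R y \<in> V \<inter> ball 0 e"
      using V c by (auto simp: subspace_scale field_simps)
    then have "(1/c) *\<^sub>R y \<in> P"
      using e by blast
    then show "y \<in> (*\<^sub>R) c ` P"
      using c by (intro image_eqI[where x = "(1/c) *\<^sub>R y"]) auto
  qed
  moreover have "(*\<^sub>R) c ` P = uminus ` (*\<^sub>R) c ` P"
  proof -
    have "uminus ` (*\<^sub>R) c ` P = (*\<^sub>R) c ` uminus ` P"
      by (simp add: image_image)
    then show ?thesis
      by (simp only: sym)
  qed
  moreover have "(*\<^sub>R) c ` P \<subseteq> V"
    using V \<open>P \<subseteq> V\<close> by (auto simp: subspace_scale)
  moreover have "0 < c * e"
    using c e by simp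
  ultimately show ?thesis
    using compact_scaling[OF \<open>compact P\<close>, of c] convex_scaling[OF \<open>convex P\<close>, of c]
    unfolding sym_convex_body_iff[OF V] by blast
qed

text \<open>A ball of radius \<open>e\<close> inside \<open>P\<close> bounds the polar by \<open>1/e\<close>, and a bound \<open>B\<close> on \<open>P\<close> puts the
  ball of radius \<open>1/B\<close> into the polar.\<close>

lemma sym_convex_body_polar:
  assumes V: "subspace V" and P: "sym_convex_body V P"
  shows "sym_convex_body V (polar V P)"
proof -
  obtain e where e: "e > 0" "V \<inter> ball 0 e \<subseteq> P" and "bounded P"
    using P compact_imp_bounded unfolding sym_convex_body_iff[OF V] by blast
  then obtain B where B: "B > 0" "\<And>x. x \<in> P \<Longrightarrow> norm x \<le> B"
    by (auto simp: bounded_pos)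
  have "norm y \<le> 2 / e" if y: "y \<in> polar V P" for y
  proof (cases "y = 0")
    case False
    \<comment> \<open>The ball is open, so the test point in direction \<open>y\<close> has norm \<open>e/2\<close>.\<close>
    define x where "x = (e / 2 / norm y) *\<^sub>R y"
    have "x \<in> V \<inter> ball 0 e"
      using y V e False by (simp add: x_def mem_polar_iff subspace_scale)
    then have "\<bar>x \<bullet> y\<bar> \<le> 1"
      using y e by (auto simp: mem_polar_iff)
    moreover have "x \<bullet> y = e / 2 * norm y"
      using False by (simp add: x_def dot_square_norm power2_eq_square)
    ultimately show ?thesis
      using e by (simp add: field_simps)
  qed (use e in simp)
  then have bounded: "bounded (polar V P)"
    by (auto simp: bounded_iff)
  have slabs: "polar V P = V \<inter> (\<Inter>x\<in>P. {y. x \<bullet> y \<le> 1} \<inter> {y. x \<bullet> y \<ge> -1})"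
    by (simp add: set_eq_iff mem_polar_iff abs_le_iff minus_le_iff)
  have "closed (polar V P)"
    unfolding slabs using V
    by (intro closed_Int closed_INT ballI closed_halfspace_le closed_halfspace_ge closed_subspace)
  moreover have "convex (polar V P)"
    unfolding slabs using V
    by (intro convex_Int convex_INT convex_halfspace_le convex_halfspace_ge subspace_imp_convex)
  moreover have "polar V P = uminus ` polar V P"
  proof -
    have neg: "- y \<in> polar V P" if "y \<in> polar V P" for y
      using that V by (simp add: mem_polar_iff subspace_neg)
    have "y \<in> uminus ` polar V P" if "y \<in> polar V P" for y
      using neg[OF that] by (intro image_eqI[of _ _ "- y"]) simp_all
    with neg show ?thesis
      by blast
  qed
  moreover have "V \<inter> ball 0 (1 / B) \<subseteq> polar V P"
  proof
    fix y assume y: "y \<in> V \<inter> ball 0 (1 / B)"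
    have "\<bar>x \<bullet> y\<bar> \<le> 1" if "x \<in> P" for x
    proof -
      have "\<bar>x \<bullet> y\<bar> \<le> norm x * norm y"
        by (rule Cauchy_Schwarz_ineq2)
      also have "\<dots> \<le> B * (1 / B)"
        using B that y by (intro mult_mono) auto
      finally show ?thesis
        using B by simp
    qed
    then show "y \<in> polar V P"
      using y by (simp add: mem_polar_iff)
  qed
  moreover have "polar V P \<subseteq> V"
    by (auto simp: mem_polar_iff)
  moreover have "0 < 1 / B"
    using B by simp
  ultimately show ?thesis
    using bounded unfolding sym_convex_body_iff[OF V] compact_eq_bounded_closed
    by (intro conjI exI[of _ "1 / B"])
qed

text \<open>The bipolar theorem relative to \<open>V\<close>. A point of \<open>V\<close> outside \<open>P\<close> is separated from \<open>P\<close> by a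
  hyperplane; its normal vector may be projected orthogonally to \<open>V\<close> without changing the
  pairings with \<open>V\<close>, and after rescaling it lies in the polar and violates the bipolar bound.\<close>

lemma polar_polar:
  assumes V: "subspace V" and P: "sym_convex_body V P"
  shows "polar V (polar V P) = P"
proof
  have PV: "P \<subseteq> V"
    using P unfolding sym_convex_body_def by blast
  show "P \<subseteq> polar V (polar V P)"
    using PV by (fastforce simp: mem_polar_iff inner_commute)
  show "polar V (polar V P) \<subseteq> P"
  proof (rule subsetI, rule ccontr)
    fix z assume z: "z \<in> polar V (polar V P)" and "z \<notin> P"
    have zV: "z \<in> V"
      using z by (simp add: mem_polar_iff)
    have "convex P" "closed P" and sym: "P = uminus ` P"
      using P compact_imp_closed unfolding sym_convex_body_def by blast+
    then obtain a b where ab: "a \<bullet> z < b" "\<And>x. x \<in> P \<Longrightarrow> a \<bullet> x > b"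
      using separating_hyperplane_closed_point[of P z] \<open>z \<notin> P\<close> by blast
    have b: "b < 0"
      using ab(2)[OF sym_convex_body_zero[OF V P]] by simp
    obtain v w where v: "v \<in> span V" and w: "\<And>x. x \<in> span V \<Longrightarrow> orthogonal w x"
      and a: "a = v + w"
      using orthogonal_subspace_decomp_exists[of V a] by blast
    have "v \<in> V"
      using v V by (metis span_eq_iff)
    have va: "v \<bullet> x = a \<bullet> x" if "x \<in> V" for x
      using w[of x] that by (simp add: a inner_add_left orthogonal_def span_base)
    define u where "u = (1 / b) *\<^sub>R v"
    have "\<bar>x \<bullet> u\<bar> \<le> 1" if x: "x \<in> P" for x
    proof -
      have "- x \<in> P"
        using sym x by blast
      then have "\<bar>a \<bullet> x\<bar> \<le> - b"
        using ab(2)[OF x] ab(2)[of "- x"] by simp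
      moreover have "x \<bullet> u = (a \<bullet> x) / b"
        using va[of x] x PV by (auto simp: u_def inner_commute)
      ultimately show ?thesis
        using b by (simp add: abs_divide le_divide_eq)
    qed
    then have "u \<in> polar V P"
      using V \<open>v \<in> V\<close> by (simp add: mem_polar_iff u_def subspace_scale)
    then have "\<bar>u \<bullet> z\<bar> \<le> 1"
      using z by (simp add: mem_polar_iff)
    moreover have "u \<bullet> z = (a \<bullet> z) / b"
      using va[OF zV] by (simp add: u_def)
    moreover have "(a \<bullet> z) / b > 1"
      using ab(1) b by (simp add: field_simps)
    ultimately show False
      by linarith
  qed
qed

section \<open>Duality and scaling of tensorial bodies\<close>

lemma elem_tensor_mem_tensor_space:
  assumes "\<And>i. x i \<in> coord_space (D i)"
  shows "elem_tensor x \<in> tensor_space D"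
  using span_elem_tensor[of D] assms by (blast intro: span_base)

lemma proj_tensor_subset_tensor_space:
  assumes "\<And>i. Qs i \<subseteq> coord_space (D i)"
  shows "proj_tensor Qs \<subseteq> tensor_space D"
  unfolding proj_tensor_def
  using assms
  by (intro hull_minimal)
    (auto intro!: elem_tensor_mem_tensor_space subspace_imp_convex subspace_tensor_space)

lemma elem_tensor_scaleR_factor:
  "elem_tensor (x(k := c *\<^sub>R y)) = c *\<^sub>R elem_tensor (x(k := y))"
proof -
  have "(\<Prod>i\<in>UNIV. (x(k := c *\<^sub>R y)) i $ f i) = c * (\<Prod>i\<in>UNIV. (x(k := y)) i $ f i)" for f
    by (simp add: prod.remove[of UNIV k] cong: prod.cong_simp)
  then show ?thesis
    by (simp add: vec_eq_iff elem_tensor_def)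
qed

lemma polar_mem_tensor_bodies:
  assumes Q: "Q \<in> tensor_bodies D Qs"
  shows "polar (tensor_space D) Q \<in> tensor_bodies D (\<lambda>i. polar (coord_space (D i)) (Qs i))"
proof -
  let ?Qs' = "\<lambda>i. polar (coord_space (D i)) (Qs i)"
  have Qs: "sym_convex_body (coord_space (D i)) (Qs i)" for i
    using Q by (simp add: tensor_bodies_def)
  have "proj_tensor ?Qs' \<subseteq> polar (tensor_space D) Q"
  proof -
    have "Q \<subseteq> polar (tensor_space D) (proj_tensor ?Qs')"
      using Q by (simp add: tensor_bodies_def inj_tensor_def)
    moreover have "proj_tensor ?Qs' \<subseteq> tensor_space D"
      by (rule proj_tensor_subset_tensor_space) (auto simp: mem_polar_iff)
    ultimately show ?thesis
      by (fastforce simp: mem_polar_iff inner_commute)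
  qed
  moreover have "polar (tensor_space D) Q \<subseteq> inj_tensor D ?Qs'"
    using Q Qs
    by (simp add: inj_tensor_def tensor_bodies_def polar_polar subspace_coord_space polar_antimono)
  ultimately show ?thesis
    using Q Qs
    by (simp add: tensor_bodies_def sym_convex_body_polar subspace_coord_space
        subspace_tensor_space)
qed

lemma scaleR_mem_tensor_bodies:
  assumes Q: "Q \<in> tensor_bodies D Qs" and c: "c > 0"
  shows "(*\<^sub>R) c ` Q \<in> tensor_bodies D (Qs(k := (*\<^sub>R) c ` Qs k))"
proof -
  let ?Qs' = "Qs(k := (*\<^sub>R) c ` Qs k)"
  have Qs: "sym_convex_body (coord_space (D i)) (Qs i)" for i
    using Q by (simp add: tensor_bodies_def)
  have bodyQ: "sym_convex_body (tensor_space D) Q"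
    and lower: "proj_tensor Qs \<subseteq> Q" and upper: "Q \<subseteq> inj_tensor D Qs"
    using Q by (simp_all add: tensor_bodies_def)
  have bodycQ: "sym_convex_body (tensor_space D) ((*\<^sub>R) c ` Q)"
    using bodyQ c by (simp add: sym_convex_body_scaleR subspace_tensor_space)
  have "proj_tensor ?Qs' \<subseteq> (*\<^sub>R) c ` Q"
    unfolding proj_tensor_def
  proof (rule hull_minimal)
    show "convex ((*\<^sub>R) c ` Q)"
      using bodycQ unfolding sym_convex_body_def by blast
    show "{elem_tensor x |x. \<forall>i. x i \<in> ?Qs' i} \<subseteq> (*\<^sub>R) c ` Q"
    proof clarify
      fix x assume x: "\<forall>i. x i \<in> ?Qs' i"
      then have "x k \<in> (*\<^sub>R) c ` Qs k"
        by (metis fun_upd_same)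
      then obtain y where y: "y \<in> Qs k" "x k = c *\<^sub>R y"
        by blast
      have "\<forall>i. (x(k := y)) i \<in> Qs i"
        using x y by (metis fun_upd_apply)
      then have "elem_tensor (x(k := y)) \<in> Q"
        using lower unfolding proj_tensor_def by (blast intro: hull_inc)
      moreover have "elem_tensor x = c *\<^sub>R elem_tensor (x(k := y))"
        using elem_tensor_scaleR_factor[of x k c y] by (simp only: fun_upd_triv flip: y(2))
      ultimately show "elem_tensor x \<in> (*\<^sub>R) c ` Q"
        by blast
    qed
  qed
  moreover have "(*\<^sub>R) c ` Q \<subseteq> inj_tensor D ?Qs'"
  proof clarify
    fix q assume q: "q \<in> Q"
    have "\<bar>elem_tensor x \<bullet> c *\<^sub>R q\<bar> \<le> 1"
      if x: "\<forall>i. x i \<in> polar (coord_space (D i)) (?Qs' i)" for x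
    proof -
      \<comment> \<open>The scalar of \<open>c *\<^sub>R q\<close> crosses the inner product and rescales the \<open>k\<close>-th factor, moving it
        from the polar of \<open>c Q\<^sub>k\<close> into the polar of \<open>Q\<^sub>k\<close>.\<close>
      let ?x' = "x(k := c *\<^sub>R x k)"
      have "x k \<in> polar (coord_space (D k)) ((*\<^sub>R) c ` Qs k)"
        using x by (metis fun_upd_same)
      then have "c *\<^sub>R x k \<in> polar (coord_space (D k)) (Qs k)"
        using c by (simp add: mem_polar_scaleR_image_iff subspace_coord_space)
      then have "\<forall>i. ?x' i \<in> polar (coord_space (D i)) (Qs i)"
        using x by (metis fun_upd_apply)
      then have "\<bar>elem_tensor ?x' \<bullet> q\<bar> \<le> 1"
        using q upper unfolding inj_tensor_def proj_tensor_def polar_convex_hull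
        unfolding mem_polar_iff[of _ "tensor_space D"] subset_iff by blast
      then show ?thesis
        by (simp add: elem_tensor_scaleR_factor)
    qed
    moreover have "c *\<^sub>R q \<in> tensor_space D"
      using bodycQ q unfolding sym_convex_body_def by blast
    ultimately show "c *\<^sub>R q \<in> inj_tensor D ?Qs'"
      unfolding inj_tensor_def proj_tensor_def polar_convex_hull
      by (auto simp: mem_polar_iff)
  qed
  ultimately show ?thesis
    using bodycQ Qs c
    by (auto simp: tensor_bodies_def sym_convex_body_scaleR subspace_coord_space)
qed

lemma tensorial_bodyI: "Q \<in> tensor_bodies D Qs \<Longrightarrow> tensorial_body D Q"
  by (auto simp: tensorial_body_def tensor_bodies_def)

theorem proposition3p5:
  fixes D :: "'l::finite \<Rightarrow> 'n::finite set"
    and Q :: "(real ^ ('l \<Rightarrow> 'n)) set"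
  assumes "\<And>i. D i \<noteq> {}"
    and "tensorial_body D Q"
  shows "tensorial_body D (polar (tensor_space D) Q) \<and>
    (\<forall>c::real. c > 0 \<longrightarrow> tensorial_body D ((*\<^sub>R) c ` Q)) \<and>
    (\<forall>Qs :: 'l \<Rightarrow> (real ^ 'n) set.
       (\<forall>i. sym_convex_body (coord_space (D i)) (Qs i)) \<and> Q \<in> tensor_bodies D Qs \<longrightarrow>
         polar (tensor_space D) Q \<in> tensor_bodies D (\<lambda>i. polar (coord_space (D i)) (Qs i)) \<and>
         (\<forall>c::real. c > 0 \<longrightarrow>
            (\<forall>k. (*\<^sub>R) c ` Q \<in> tensor_bodies D (Qs(k := (*\<^sub>R) c ` Qs k)))))"
proof -
  obtain Qs where "Q \<in> tensor_bodies D Qs"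
    using assms(2) by (auto simp: tensorial_body_def)
  then have "tensorial_body D (polar (tensor_space D) Q)"
    and "\<forall>c::real. c > 0 \<longrightarrow> tensorial_body D ((*\<^sub>R) c ` Q)"
    by (blast intro: tensorial_bodyI polar_mem_tensor_bodies scaleR_mem_tensor_bodies)+
  then show ?thesis
    by (simp add: polar_mem_tensor_bodies scaleR_mem_tensor_bodies)
qed

end
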